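(* For all integers $k\ge 0$ and $\ell_1,\ldots,\ell_k \geq 1$, in the game $\mathbf{0.33}$ we have $\mathcal{G}(S_{\ell_1,\ldots,\ell_k})=\mathcal{G}(S_{\ell_1 \bmod 3,\ldots,\ell_k \bmod 3})$.
   Context: The game $\mathbf{0.33}$ on a finite graph $G$: players alternate; a move chooses a set $X$ of one vertex or of two adjacent vertices of $G$, lying in a connected component $H$ of $G$, such that $H-X$ is empty or connected, and deletes $X$. A player unable to move loses (normal play). Grundy value: $\mathcal{G}(G)=\mathrm{mex}\{\mathcal{G}(G'): G' \text{ reachable in one move}\}$, with $\mathrm{mex}(A)$ the least nonnegative integer not in $A$. Subdivided star $S_{\ell_1,\ldots,\ell_k}$ ($k\ge0$): a central vertex $c$ together with $k$ vertex-disjoint paths having $\ell_1,\ldots,\ell_k$ vertices respectively, each path having one endpoint adjacent to $c$. In particular, with $k=0$ it is the single vertex $P_1$. An index equal to $0$ means that no path is attached (such entries are simply omitted), so e.g. $S_{3,1}$ reduces to $S_{0,1}=S_{1}=P_2$. *)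

theory Defs
  imports Main
begin

text \<open>Undirected graphs are represented by a symmetric set of ordered pairs of vertices.\<close>

datatype 'a ugraph = Graph (verts: "'a set") (edges: "'a rel")

definition finite_simple_graph :: "'a ugraph \<Rightarrow> bool" where
  "finite_simple_graph G \<longleftrightarrow>
     finite (verts G) \<and> edges G \<subseteq> verts G \<times> verts G \<and> sym (edges G) \<and> irrefl (edges G)"

definition induced :: "'a ugraph \<Rightarrow> 'a set \<Rightarrow> 'a ugraph" where
  "induced G W = Graph (verts G \<inter> W) (Restr (edges G) W)"

definition connected_graph :: "'a ugraph \<Rightarrow> bool" where
  "connected_graph G \<longleftrightarrow>
     verts G \<noteq> {} \<and> (\<forall>u\<in>verts G. \<forall>v\<in>verts G. (u, v) \<in> (edges G)\<^sup>*)"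

definition components :: "'a ugraph \<Rightarrow> 'a set set" where
  "components G = verts G // (edges G)\<^sup>*"

definition legal_033 :: "'a ugraph \<Rightarrow> 'a set \<Rightarrow> bool" where
  "legal_033 G X \<longleftrightarrow>
     ((\<exists>u\<in>verts G. X = {u}) \<or> (\<exists>u v. (u, v) \<in> edges G \<and> X = {u, v})) \<and>
     (\<exists>H\<in>components G. X \<subseteq> H \<and> (H - X = {} \<or> connected_graph (induced G (H - X))))"

text \<open>The game is only played on finite simple graphs; the first conjunct makes the recursion
  for the Grundy value below well-founded on the whole type.\<close>

definition moves_033 :: "'a ugraph \<Rightarrow> 'a ugraph set" where
  "moves_033 G = {G'. finite_simple_graph G \<and>
     (\<exists>X. legal_033 G X \<and> G' = induced G (verts G - X))}"

lemma finite_simple_graph_moves: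
  assumes "G' \<in> moves_033 G"
  shows "finite_simple_graph G'"
  using assms
  by (auto simp: moves_033_def finite_simple_graph_def induced_def sym_def irrefl_def)

lemma card_verts_moves:
  assumes "G' \<in> moves_033 G"
  shows "card (verts G') < card (verts G)"
proof -
  obtain X where X: "finite_simple_graph G" "legal_033 G X" "G' = induced G (verts G - X)"
    using assms by (auto simp: moves_033_def)
  then have "verts G' \<subset> verts G"
    by (auto simp: legal_033_def finite_simple_graph_def induced_def)
  with X(1) show ?thesis
    by (simp add: finite_simple_graph_def psubset_card_mono)
qed

definition mex :: "nat set \<Rightarrow> nat" where
  "mex A = (LEAST n. n \<notin> A)"

function grundy_033 :: "'a ugraph \<Rightarrow> nat" where
  "grundy_033 G = mex (grundy_033 ` moves_033 G)"
  by auto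
termination
  by (relation "measure (\<lambda>G. card (verts G))") (auto simp: card_verts_moves)

declare grundy_033.simps [simp del]

datatype star_vertex = Centre | Arm nat nat

text \<open>\<open>Arm i j\<close> is the vertex of the \<open>i\<close>-th path at distance \<open>j + 1\<close> from the centre
  (both indices start at 0). An entry 0 of the list contributes neither vertices nor edges.\<close>

definition star_arcs :: "nat list \<Rightarrow> star_vertex rel" where
  "star_arcs ls =
     {(Centre, Arm i 0) | i. i < length ls \<and> 0 < ls ! i} \<union>
     {(Arm i j, Arm i (Suc j)) | i j. i < length ls \<and> Suc j < ls ! i}"

definition subdivided_star :: "nat list \<Rightarrow> star_vertex ugraph" where
  "subdivided_star ls =
     Graph (insert Centre {Arm i j | i j. i < length ls \<and> j < ls ! i})
           (star_arcs ls \<union> (star_arcs ls)\<inverse>)"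

lemma finite_simple_graph_subdivided_star: "finite_simple_graph (subdivided_star ls)"
proof -
  have "{Arm i j | i j. i < length ls \<and> j < ls ! i}
      = (\<lambda>(i, j). Arm i j) ` (SIGMA i:{..<length ls}. {..<ls ! i})"
    by (auto simp: image_iff)
  then have "finite {Arm i j | i j. i < length ls \<and> j < ls ! i}"
    by simp
  then show ?thesis
    by (auto simp: finite_simple_graph_def subdivided_star_def star_arcs_def sym_def irrefl_def)
qed

end

theory Submission imports Defs begin

text \<open>
  It suffices that lengthening one arm by 3 preserves the Grundy value; let \<open>S'\<close> arise from \<open>S\<close>
  in this way. A path on \<open>n\<close> vertices has value \<open>n mod 3\<close>, which settles the case that \<open>S'\<close> is a
  path. Otherwise every move in \<open>S'\<close> shortens an arm by 1 or 2. If it shortens the lengthened arm,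
  the result has \<open>S\<close> as an option, so its value is not that of \<open>S\<close>. If it shortens another
  arm, the same move in \<open>S\<close> has the same value by induction, so it differs from that of \<open>S\<close> as
  well. Conversely, each value below that of \<open>S\<close> is attained by shortening an arm of \<open>S\<close>, hence,
  again by induction, by the same move in \<open>S'\<close>.
\<close>

section \<open>Grundy values\<close>

text \<open>Finiteness guarantees a natural number outside the set of option values, so that the
  \<open>LEAST\<close> in \<open>mex\<close> is attained.\<close>

lemma finite_moves_033: "finite (moves_033 G)"
proof (cases "finite_simple_graph G")
  case True
  then have "moves_033 G \<subseteq> (\<lambda>X. induced G (verts G - X)) ` Pow (verts G)"
    by (auto simp: moves_033_def legal_033_def finite_simple_graph_def)
  with True show ?thesis
    by (meson finite_Pow_iff finite_imageI finite_simple_graph_def finite_subset)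
qed (simp add: moves_033_def)

lemma mex_notin: "finite A \<Longrightarrow> mex A \<notin> A"
  unfolding mex_def by (rule LeastI_ex) (rule ex_new_if_finite[OF infinite_UNIV_nat])

lemma less_mex_in: "m < mex A \<Longrightarrow> m \<in> A"
  unfolding mex_def using not_less_Least by blast

lemma mex_eqI: "n \<notin> A \<Longrightarrow> (\<And>m. m < n \<Longrightarrow> m \<in> A) \<Longrightarrow> mex A = n"
  unfolding mex_def by (rule Least_equality) (auto simp: not_le[symmetric])

lemma grundy_033_move_neq: "G' \<in> moves_033 G \<Longrightarrow> grundy_033 G' \<noteq> grundy_033 G"
  using mex_notin[of "grundy_033 ` moves_033 G"]
  by (metis finite_imageI finite_moves_033 grundy_033.simps imageI)

lemma less_grundy_033_obtain_move:
  assumes "m < grundy_033 G"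
  obtains G' where "G' \<in> moves_033 G" "grundy_033 G' = m"
  using assms less_mex_in[of m "grundy_033 ` moves_033 G"]
  by (metis grundy_033.simps imageE)

lemma grundy_033_eqI:
  assumes "\<And>G'. G' \<in> moves_033 G \<Longrightarrow> grundy_033 G' \<noteq> n"
    and "\<And>m. m < n \<Longrightarrow> \<exists>G'\<in>moves_033 G. grundy_033 G' = m"
  shows "grundy_033 G = n"
  by (subst grundy_033.simps, rule mex_eqI) (use assms in fastforce)+

section \<open>Moves on connected graphs\<close>

lemma components_connected_graph:
  assumes "finite_simple_graph G" "connected_graph G"
  shows "components G = {verts G}"
proof -
  have "(edges G)\<^sup>* `` {x} = verts G" if "x \<in> verts G" for x
  proof
    have "edges G `` verts G \<subseteq> verts G"
      using assms(1) by (auto simp: finite_simple_graph_def)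
    then have "(edges G)\<^sup>* `` verts G = verts G"
      by (rule Image_closed_trancl)
    with that show "(edges G)\<^sup>* `` {x} \<subseteq> verts G" by blast
    show "verts G \<subseteq> (edges G)\<^sup>* `` {x}"
      using that assms(2) by (auto simp: connected_graph_def)
  qed
  moreover have "verts G \<noteq> {}"
    using assms(2) by (simp add: connected_graph_def)
  ultimately show ?thesis
    by (auto simp: components_def quotient_def)
qed

text \<open>In a connected graph the whole vertex set is the only component, so the quantifier over
  components in \<open>legal_033\<close> disappears.\<close>

lemma moves_033_connected_graph:
  assumes "finite_simple_graph G" "connected_graph G"
  shows "G' \<in> moves_033 G \<longleftrightarrow>
    (\<exists>X. ((\<exists>u\<in>verts G. X = {u}) \<or> (\<exists>u v. (u, v) \<in> edges G \<and> X = {u, v})) \<and>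
      (verts G - X = {} \<or> connected_graph (induced G (verts G - X))) \<and>
      G' = induced G (verts G - X))"
proof -
  have "X \<subseteq> verts G" if "(\<exists>u\<in>verts G. X = {u}) \<or> (\<exists>u v. (u, v) \<in> edges G \<and> X = {u, v})" for X
    using that assms(1) by (auto simp: finite_simple_graph_def)
  then have "legal_033 G X \<longleftrightarrow>
      ((\<exists>u\<in>verts G. X = {u}) \<or> (\<exists>u v. (u, v) \<in> edges G \<and> X = {u, v})) \<and>
      (verts G - X = {} \<or> connected_graph (induced G (verts G - X)))" for X
    unfolding legal_033_def components_connected_graph[OF assms] bex_simps
    by (metis (no_types, lifting))
  then show ?thesis
    by (simp only: moves_033_def mem_Collect_eq assms(1) simp_thms conj_assoc)
qed

text \<open>A walk that starts in an edge-closed set never leaves it. All illegal deletions below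
  are refuted by exhibiting such a set.\<close>

lemma not_connected_graphI:
  assumes "x \<in> A" "x \<in> verts G" "y \<in> verts G" "y \<notin> A" "edges G `` A \<subseteq> A"
  shows "\<not> connected_graph G"
proof
  assume "connected_graph G"
  then have "(x, y) \<in> (edges G)\<^sup>*"
    using assms by (auto simp: connected_graph_def)
  moreover have "(edges G)\<^sup>* `` A = A"
    using assms(5) by (rule Image_closed_trancl)
  ultimately show False using assms by blast
qed

lemma connected_graphI_root:
  assumes "sym (edges G)" "r \<in> verts G" "\<And>v. v \<in> verts G \<Longrightarrow> (r, v) \<in> (edges G)\<^sup>*"
  shows "connected_graph G"
  unfolding connected_graph_def
proof (intro conjI ballI)
  show "verts G \<noteq> {}" using assms(2) by blast
  fix u v assume "u \<in> verts G" "v \<in> verts G"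
  then have "(r, u) \<in> (edges G)\<^sup>*" "(r, v) \<in> (edges G)\<^sup>*"
    by (auto intro: assms(3))
  moreover from this have "(u, r) \<in> (edges G)\<^sup>*"
    using symD[OF sym_rtrancl[OF assms(1)]] by blast
  ultimately show "(u, v) \<in> (edges G)\<^sup>*" by (meson rtrancl_trans)
qed

section \<open>Paths\<close>

text \<open>The labelling \<open>f\<close> and the interval are kept apart so that a subpath is the
  same \<open>f\<close> on a smaller interval, and so that \<open>f\<close> can run through the
  vertices of a star. An empty interval gives the empty graph.\<close>

definition path_graph :: "(nat \<Rightarrow> 'a) \<Rightarrow> nat \<Rightarrow> nat \<Rightarrow> 'a ugraph" where
  "path_graph f a b = Graph (f ` {a..<b})
     ({(f i, f (Suc i)) | i. a \<le> i \<and> Suc i < b} \<union> {(f (Suc i), f i) | i. a \<le> i \<and> Suc i < b})"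

lemma finite_simple_graph_path_graph:
  assumes "inj_on f {a..<b}"
  shows "finite_simple_graph (path_graph f a b)"
proof -
  have "f i \<noteq> f (Suc i)" if "a \<le> i" "Suc i < b" for i
    using inj_onD[OF assms, of i "Suc i"] that by auto
  then show ?thesis
    by (auto simp: finite_simple_graph_def path_graph_def sym_def irrefl_def) metis
qed

lemma connected_graph_path_graph:
  assumes "a < b"
  shows "connected_graph (path_graph f a b)"
proof (rule connected_graphI_root)
  let ?E = "edges (path_graph f a b)"
  show "sym ?E" by (auto simp: path_graph_def sym_def)
  show "f a \<in> verts (path_graph f a b)" using assms by (simp add: path_graph_def)
  have "(f a, f (a + n)) \<in> ?E\<^sup>*" if "a + n < b" for n
    using that
  proof (induction n)
    case (Suc n)
    then have "(f (a + n), f (a + Suc n)) \<in> ?E" by (auto simp: path_graph_def)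
    with Suc show ?case by (auto intro: rtrancl.rtrancl_into_rtrancl)
  qed simp
  then have reach: "(f a, f i) \<in> ?E\<^sup>*" if "a \<le> i" "i < b" for i
    using that by (metis le_add_diff_inverse)
  show "(f a, v) \<in> ?E\<^sup>*" if "v \<in> verts (path_graph f a b)" for v
  proof -
    have "v \<in> f ` {a..<b}" using that by (simp add: path_graph_def)
    with reach show ?thesis by auto
  qed
qed

lemma induced_path_graph:
  assumes "inj_on f {a..<b}" "a \<le> a'" "b' \<le> b"
  shows "induced (path_graph f a b) (f ` {a'..<b'}) = path_graph f a' b'"
proof -
  have mem: "f i \<in> f ` {a'..<b'} \<longleftrightarrow> i \<in> {a'..<b'}" if "i \<in> {a..<b}" for i
    using assms that by (intro inj_on_image_mem_iff[of f "{a..<b}"]) auto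
  have "f ` {a..<b} \<inter> f ` {a'..<b'} = f ` {a'..<b'}"
    using assms(2,3) by auto
  moreover have "Restr (edges (path_graph f a b)) (f ` {a'..<b'}) = edges (path_graph f a' b')"
  proof (intro equalityI subsetI)
    fix x assume x: "x \<in> Restr (edges (path_graph f a b)) (f ` {a'..<b'})"
    then obtain i where i: "a \<le> i" "Suc i < b" "x = (f i, f (Suc i)) \<or> x = (f (Suc i), f i)"
      by (auto simp: path_graph_def)
    have "x \<in> f ` {a'..<b'} \<times> f ` {a'..<b'}" using x by blast
    with i(3) have "f i \<in> f ` {a'..<b'} \<and> f (Suc i) \<in> f ` {a'..<b'}"
      by (elim disjE) (simp_all only: mem_Sigma_iff)
    then have "a' \<le> i" "Suc i < b'" using i mem[of i] mem[of "Suc i"] by simp_all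
    with i(3) show "x \<in> edges (path_graph f a' b')" by (auto simp: path_graph_def)
  next
    fix x assume "x \<in> edges (path_graph f a' b')"
    then obtain i where i: "a' \<le> i" "Suc i < b'" "x = (f i, f (Suc i)) \<or> x = (f (Suc i), f i)"
      by (auto simp: path_graph_def)
    then have "f i \<in> f ` {a'..<b'}" "f (Suc i) \<in> f ` {a'..<b'}" by simp_all
    moreover have "a \<le> i" "Suc i < b" using i assms(2,3) by simp_all
    ultimately show "x \<in> Restr (edges (path_graph f a b)) (f ` {a'..<b'})"
      using i(3) by (auto simp: path_graph_def)
  qed
  ultimately show ?thesis
    by (simp add: induced_def path_graph_def)
qed

text \<open>Deleting a block of one or two vertices away from both ends would disconnect the path,
  so only the two ends can be shortened.\<close>

lemma moves_033_path_graph: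
  assumes inj: "inj_on f {a..<b}" and "a < b"
  shows "moves_033 (path_graph f a b) =
    {path_graph f (a + d) b | d. d \<in> {1, 2} \<and> a + d \<le> b} \<union>
    {path_graph f a (b - d) | d. d \<in> {1, 2} \<and> a + d \<le> b}"
    (is "?M = ?R")
proof -
  let ?G = "path_graph f a b"
  note mv = moves_033_connected_graph[OF finite_simple_graph_path_graph[OF inj]
      connected_graph_path_graph[OF \<open>a < b\<close>]]
  have diff: "f ` {a..<b} - f ` S = f ` ({a..<b} - S)" if "S \<subseteq> {a..<b}" for S
    using inj that by (metis Diff_subset inj_on_image_set_diff)
  have V: "verts ?G = f ` {a..<b}" by (simp add: path_graph_def)
  \<comment> \<open>Both kinds of deletion are treated uniformly as the image of an index block of
    length \<open>d\<close>.\<close>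
  have X: "((\<exists>u\<in>verts ?G. X = {u}) \<or> (\<exists>u v. (u, v) \<in> edges ?G \<and> X = {u, v})) \<longleftrightarrow>
      (\<exists>i d. a \<le> i \<and> i + d \<le> b \<and> d \<in> {1, 2} \<and> X = f ` {i..<i + d})" (is "?L X \<longleftrightarrow> ?Q X") for X
  proof -
    have 1: "{i..<i + 1} = {i}" "{i..<i + 2} = {i, Suc i}" for i :: nat by auto
    show ?thesis
    proof
      assume "?L X"
      then consider i where "a \<le> i" "i < b" "X = {f i}"
        | i where "a \<le> i" "Suc i < b" "X = {f i, f (Suc i)}"
        by (auto simp: path_graph_def)
      then show "?Q X"
      proof cases
        case 1
        then show ?thesis by (intro exI[of _ i] exI[of _ 1]) auto
      next
        case (2 i)
        then show ?thesis using 1 by (intro exI[of _ i] exI[of _ 2]) auto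
      qed
    next
      assume "?Q X"
      then consider i where "a \<le> i" "i < b" "X = {f i}"
        | i where "a \<le> i" "Suc i < b" "X = {f i, f (Suc i)}"
        using 1 by fastforce
      then show "?L X"
      proof cases
        case (2 i)
        then have "(f i, f (Suc i)) \<in> edges ?G" by (auto simp: path_graph_def)
        with 2 show ?thesis by blast
      qed (auto simp: path_graph_def)
    qed
  qed
  show ?thesis
  proof (intro equalityI subsetI)
    fix G' assume "G' \<in> ?M"
    then obtain i d where id: "a \<le> i" "i + d \<le> b" "d \<in> {1, 2}"
      and con: "verts ?G - f ` {i..<i + d} = {} \<or>
        connected_graph (induced ?G (verts ?G - f ` {i..<i + d}))"
      and G': "G' = induced ?G (verts ?G - f ` {i..<i + d})"
      unfolding mv X by blast
    have rest: "verts ?G - f ` {i..<i + d} = f ` ({a..<b} - {i..<i + d})"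
      unfolding V using id by (intro diff) auto
    have "i = a \<or> i + d = b"
    proof (rule ccontr)
      assume H: "\<not> (i = a \<or> i + d = b)"
      let ?D = "{a..<b} - {i..<i + d}"
      have mem: "f m \<in> f ` A \<longleftrightarrow> m \<in> A" if "m \<in> {a..<b}" "A \<subseteq> {a..<b}" for m A
        using inj that by (rule inj_on_image_mem_iff)
      have mD: "f m \<in> f ` ?D \<longleftrightarrow> m \<in> ?D" if "m \<in> {a..<b}" for m
        using that by (intro mem) auto
      have mA: "f m \<in> f ` {a..<i} \<longleftrightarrow> m \<in> {a..<i}" if "m \<in> {a..<b}" for m
        using that id by (intro mem) auto
      have "\<not> connected_graph (induced ?G (f ` ?D))"
      \<comment> \<open>The segment before the deleted block is edge-closed: its only neighbour
        outside is \<open>f i\<close>, which is deleted. The last vertex \<open>f (b - 1)\<close>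
        survives on the other side.\<close>
      proof (rule not_connected_graphI[where A = "f ` {a..<i}"])
        show "f a \<in> f ` {a..<i}" using H id by auto
        show "f a \<in> verts (induced ?G (f ` ?D))"
          using H id by (auto simp: induced_def path_graph_def)
        have "b - 1 \<in> ?D" using H id by auto
        then show "f (b - 1) \<in> verts (induced ?G (f ` ?D))"
          by (auto simp: induced_def path_graph_def)
        show "f (b - 1) \<notin> f ` {a..<i}"
        proof -
          have "i \<le> b - 1" using H id by auto
          with mA[of "b - 1"] \<open>b - 1 \<in> ?D\<close> show ?thesis by simp
        qed
        show "edges (induced ?G (f ` ?D)) `` (f ` {a..<i}) \<subseteq> f ` {a..<i}"
        proof
          fix y assume "y \<in> edges (induced ?G (f ` ?D)) `` (f ` {a..<i})"
          then obtain x where x: "x \<in> f ` {a..<i}" "(x, y) \<in> edges ?G" "x \<in> f ` ?D" "y \<in> f ` ?D"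
            by (auto simp: induced_def)
          from x(2) consider m where "a \<le> m" "Suc m < b" "x = f m" "y = f (Suc m)"
            | m where "a \<le> m" "Suc m < b" "y = f m" "x = f (Suc m)"
            by (auto simp: path_graph_def)
          then show "y \<in> f ` {a..<i}"
          proof cases
            case (1 m)
            with x have "m < i" "Suc m \<in> ?D" using mA[of m] mD[of "Suc m"] by auto
            with 1 id show ?thesis by auto
          next
            case (2 m)
            with x have "Suc m < i" using mA[of "Suc m"] by auto
            with 2 show ?thesis by auto
          qed
        qed
      qed
      moreover have "f ` ?D \<noteq> {}" using H id by auto
      ultimately show False using con unfolding rest by blast
    qed
    then show "G' \<in> ?R"
    proof
      assume "i = a"
      then have "{a..<b} - {i..<i + d} = {a + d..<b}" using id by auto
      then have "G' = path_graph f (a + d) b"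
        unfolding G' rest using induced_path_graph[OF inj, of "a + d" b] by simp
      with id \<open>i = a\<close> show ?thesis by blast
    next
      assume "i + d = b"
      then have "{a..<b} - {i..<i + d} = {a..<b - d}" using id by auto
      then have "G' = path_graph f a (b - d)"
        unfolding G' rest using induced_path_graph[OF inj, of a "b - d"] by simp
      with id \<open>i + d = b\<close> show ?thesis by auto
    qed
  next
    fix G' assume "G' \<in> ?R"
    \<comment> \<open>Both ends are handled at once: block \<open>{i..<i + d}\<close> is deleted and
      interval \<open>{a'..<b'}\<close> remains.\<close>
    obtain i d a' b' where *: "a \<le> i" "i + d \<le> b" "d \<in> {1, 2}" "G' = path_graph f a' b'"
      "{a..<b} - {i..<i + d} = {a'..<b'}" "a \<le> a'" "b' \<le> b"
    proof -
      from \<open>G' \<in> ?R\<close>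
      consider d where "G' = path_graph f (a + d) b" "d \<in> {1, 2}" "a + d \<le> b"
        | d where "G' = path_graph f a (b - d)" "d \<in> {1, 2}" "a + d \<le> b"
        by blast
      then show thesis
      proof cases
        case (1 d)
        then show ?thesis by (intro that[of a d "a + d" b]) auto
      next
        case (2 d)
        then show ?thesis by (intro that[of "b - d" d a "b - d"]) auto
      qed
    qed
    have rest: "verts ?G - f ` {i..<i + d} = f ` {a'..<b'}"
      unfolding V *(5)[symmetric] using * by (intro diff) auto
    have G': "G' = induced ?G (verts ?G - f ` {i..<i + d})"
      unfolding rest using induced_path_graph[OF inj *(6,7)] * by simp
    have "verts ?G - f ` {i..<i + d} = {} \<or> connected_graph G'"
    proof (cases "a' < b'")
      case True
      then show ?thesis using *(4) by (simp add: connected_graph_path_graph)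
    qed (simp add: rest)
    then show "G' \<in> ?M"
      unfolding mv X using * G' by blast
  qed
qed

section \<open>Grundy values of paths\<close>

lemma diff_mod_3_neq:
  fixes n d :: nat
  assumes "d \<in> {1, 2}" "d \<le> n"
  shows "(n - d) mod 3 \<noteq> n mod 3"
proof -
  obtain k where "n = d + k" using assms(2) le_Suc_ex by blast
  moreover have "k mod 3 \<noteq> (1 + k) mod 3" "k mod 3 \<noteq> (2 + k) mod 3" by presburger+
  ultimately show ?thesis using assms(1) by auto
qed

text \<open>The witness is \<open>n mod 3 - m\<close>: it is positive, at most 2, and subtracting it
  does not cross a multiple of 3.\<close>

lemma less_mod_3_obtain_diff:
  fixes m n :: nat
  assumes "m < n mod 3"
  obtains d where "d \<in> {1, 2}" "d \<le> n" "(n - d) mod 3 = m"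
proof -
  have "n mod 3 < 3" by simp
  with assms have 1: "n mod 3 - m \<in> {1, 2}" "m < 3" by auto
  have "n - (n mod 3 - m) = 3 * (n div 3) + m"
    using mult_div_mod_eq[of 3 n] assms by linarith
  with 1 show thesis by (intro that[of "n mod 3 - m"]) (auto intro: le_trans)
qed

text \<open>Shortening at either end leaves the same number of vertices, so the game on a path is
  the subtraction game with set {1, 2}.\<close>

lemma grundy_033_path_graph:
  assumes "inj_on f {a..<b}" "a \<le> b"
  shows "grundy_033 (path_graph f a b) = (b - a) mod 3"
  using assms
proof (induction "b - a" arbitrary: a b rule: less_induct)
  case less
  show ?case
  proof (cases "a = b")
    case True
    then show ?thesis
      by (intro grundy_033_eqI)
        (auto simp: path_graph_def moves_033_def legal_033_def)
  next
    case False
    with less have ab: "a < b" by simp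
    have L: "grundy_033 (path_graph f (a + d) b) = (b - a - d) mod 3"
      and R: "grundy_033 (path_graph f a (b - d)) = (b - a - d) mod 3"
      if "d \<in> {1, 2}" "a + d \<le> b" for d
    proof -
      have "inj_on f {a + d..<b}" "inj_on f {a..<b - d}"
        by (rule inj_on_subset[OF less.prems(1)]; auto)+
      then show "grundy_033 (path_graph f (a + d) b) = (b - a - d) mod 3"
        "grundy_033 (path_graph f a (b - d)) = (b - a - d) mod 3"
        using less.hyps[of b "a + d"] less.hyps[of "b - d" a] that
        by (auto simp: diff_commute)
    qed
    show ?thesis
    proof (rule grundy_033_eqI)
      fix G' assume "G' \<in> moves_033 (path_graph f a b)"
      then obtain d where d: "d \<in> {1, 2}" "a + d \<le> b"
        "grundy_033 G' = (b - a - d) mod 3"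
        unfolding moves_033_path_graph[OF less.prems(1) ab] using L R by blast
      then show "grundy_033 G' \<noteq> (b - a) mod 3"
        using diff_mod_3_neq[of d "b - a"] by simp
    next
      fix m assume "m < (b - a) mod 3"
      then obtain d where d: "d \<in> {1, 2}" "d \<le> b - a" "(b - a - d) mod 3 = m"
        by (rule less_mod_3_obtain_diff)
      then have "path_graph f (a + d) b \<in> moves_033 (path_graph f a b)"
        unfolding moves_033_path_graph[OF less.prems(1) ab] using ab by auto
      with L[of d] d ab show "\<exists>G'\<in>moves_033 (path_graph f a b). grundy_033 G' = m"
        by (intro bexI) auto
    qed
  qed
qed


section \<open>Subdivided stars\<close>

lemma verts_subdivided_star [simp]:
  "Centre \<in> verts (subdivided_star ls)"
  "Arm i j \<in> verts (subdivided_star ls) \<longleftrightarrow> i < length ls \<and> j < ls ! i"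
  by (auto simp: subdivided_star_def)

lemma edges_subdivided_star [simp]:
  "(Centre, Centre) \<notin> edges (subdivided_star ls)"
  "(Centre, Arm i j) \<in> edges (subdivided_star ls) \<longleftrightarrow> j = 0 \<and> i < length ls \<and> 0 < ls ! i"
  "(Arm i j, Centre) \<in> edges (subdivided_star ls) \<longleftrightarrow> j = 0 \<and> i < length ls \<and> 0 < ls ! i"
  "(Arm i j, Arm i' j') \<in> edges (subdivided_star ls) \<longleftrightarrow>
     i' = i \<and> i < length ls \<and> (j' = Suc j \<and> Suc j < ls ! i \<or> j = Suc j' \<and> Suc j' < ls ! i)"
  by (auto simp: subdivided_star_def star_arcs_def)

lemma star_vertex_set_eqI:
  assumes "Centre \<in> A \<longleftrightarrow> Centre \<in> B" "\<And>i j. Arm i j \<in> A \<longleftrightarrow> Arm i j \<in> B"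
  shows "A = B"
proof (rule set_eqI)
  show "x \<in> A \<longleftrightarrow> x \<in> B" for x using assms by (cases x) auto
qed

lemma star_vertex_rel_eqI:
  assumes "(Centre, Centre) \<in> A \<longleftrightarrow> (Centre, Centre) \<in> B"
    and "\<And>i j. (Centre, Arm i j) \<in> A \<longleftrightarrow> (Centre, Arm i j) \<in> B"
    and "\<And>i j. (Arm i j, Centre) \<in> A \<longleftrightarrow> (Arm i j, Centre) \<in> B"
    and "\<And>i j i' j'. (Arm i j, Arm i' j') \<in> A \<longleftrightarrow> (Arm i j, Arm i' j') \<in> B"
  shows "A = B"
proof -
  have "(x, y) \<in> A \<longleftrightarrow> (x, y) \<in> B" for x y
    using assms by (cases x; cases y) auto
  then show ?thesis by auto
qed

lemma connected_graph_subdivided_star: "connected_graph (subdivided_star ls)"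
proof (rule connected_graphI_root)
  let ?E = "edges (subdivided_star ls)"
  show "sym ?E"
    using finite_simple_graph_subdivided_star by (auto simp: finite_simple_graph_def)
  show "Centre \<in> verts (subdivided_star ls)" by simp
  have "(Centre, Arm i j) \<in> ?E\<^sup>*" if "i < length ls" "j < ls ! i" for i j
    using that
  proof (induction j)
    case 0
    then show ?case by (intro r_into_rtrancl) simp
  next
    case (Suc j)
    then have "(Centre, Arm i j) \<in> ?E\<^sup>*" by simp
    also have "(Arm i j, Arm i (Suc j)) \<in> ?E" using Suc by simp
    finally show ?case .
  qed
  then show "(Centre, v) \<in> ?E\<^sup>*" if "v \<in> verts (subdivided_star ls)" for v
    using that by (cases v) auto
qed

lemmas moves_033_subdivided_star =
  moves_033_connected_graph[OF finite_simple_graph_subdivided_star connected_graph_subdivided_star]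

text \<open>Arm positions are counted from the centre and a used-up arm keeps its entry 0, so no
  vertex is renamed. The graphs are therefore equal, not merely isomorphic, and invariance of Grundy
  values under isomorphism never comes up.\<close>

lemma induced_subdivided_star_shorten:
  assumes "i < length ls" "d \<le> ls ! i"
  shows "induced (subdivided_star ls)
      (verts (subdivided_star ls) - Arm i ` {ls ! i - d..<ls ! i})
    = subdivided_star (ls[i := ls ! i - d])"
proof -
  let ?G = "subdivided_star ls" and ?H = "subdivided_star (ls[i := ls ! i - d])"
  let ?W = "verts ?G - Arm i ` {ls ! i - d..<ls ! i}"
  have W: "Centre \<in> ?W"
    "Arm i' j \<in> ?W \<longleftrightarrow> i' < length ls \<and> j < (if i' = i then ls ! i - d else ls ! i')" for i' j
    using assms by auto
  have "verts ?G \<inter> ?W = verts ?H"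
    using W assms by (intro star_vertex_set_eqI) (auto simp: nth_list_update)
  moreover have "Restr (edges ?G) ?W = edges ?H"
    using W assms
    by (intro star_vertex_rel_eqI) (auto simp: nth_list_update simp del: DiffI split: if_splits)
  ultimately show ?thesis
    by (metis induced_def ugraph.collapse)
qed

text \<open>Always legal: what remains is again a subdivided star, hence connected.\<close>

lemma shorten_arm_in_moves_033:
  assumes "i < length ls" "d \<in> {1, 2}" "d \<le> ls ! i"
  shows "subdivided_star (ls[i := ls ! i - d]) \<in> moves_033 (subdivided_star ls)"
proof -
  let ?G = "subdivided_star ls"
  let ?X = "Arm i ` {ls ! i - d..<ls ! i}"
  have "(\<exists>u\<in>verts ?G. ?X = {u}) \<or> (\<exists>u v. (u, v) \<in> edges ?G \<and> ?X = {u, v})"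
  proof (cases "d = 1")
    case True
    then have "{ls ! i - d..<ls ! i} = {ls ! i - 1}" using assms by auto
    then have "?X = {Arm i (ls ! i - 1)}" by simp
    then show ?thesis using assms True by auto
  next
    case False
    then have "{ls ! i - d..<ls ! i} = {ls ! i - 2, ls ! i - 1}" using assms by auto
    then have "?X = {Arm i (ls ! i - 2), Arm i (ls ! i - 1)}" by simp
    moreover have "(Arm i (ls ! i - 2), Arm i (ls ! i - 1)) \<in> edges ?G"
      using assms False by auto
    ultimately show ?thesis by blast
  qed
  then show ?thesis
    unfolding moves_033_subdivided_star
    using induced_subdivided_star_shorten[OF assms(1,3)] connected_graph_subdivided_star
    by (intro exI[of _ ?X]) simp
qed

section \<open>Number of arms, and moves on stars with at least three arms\<close>

text \<open>Entries 0 stay in the list when an arm is used up, so \<open>length ls\<close> does not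
  count the arms.\<close>

definition num_arms :: "nat list \<Rightarrow> nat" where
  "num_arms ls = length (filter ((<) 0) ls)"

lemma num_arms_eq_card: "num_arms ls = card {i. i < length ls \<and> 0 < ls ! i}"
  by (simp add: num_arms_def length_filter_conv_card)

lemma obtain_other_arm:
  assumes "card S < num_arms ls" "finite S"
  obtains i where "i < length ls" "0 < ls ! i" "i \<notin> S"
proof -
  have "\<not> {i. i < length ls \<and> 0 < ls ! i} \<subseteq> S"
    using assms card_mono[of S] unfolding num_arms_eq_card by (meson leD)
  then show thesis using that by auto
qed

text \<open>Every other deletion separates the tail of an arm from a vertex outside that tail.\<close>

lemma moves_033_many_arms:
  assumes "3 \<le> num_arms ls" "G' \<in> moves_033 (subdivided_star ls)"
  obtains i d where "i < length ls" "d \<in> {1, 2}" "d \<le> ls ! i"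
    "G' = subdivided_star (ls[i := ls ! i - d])"
proof -
  let ?G = "subdivided_star ls"
  obtain X where X: "(\<exists>u\<in>verts ?G. X = {u}) \<or> (\<exists>u v. (u, v) \<in> edges ?G \<and> X = {u, v})"
    and con: "verts ?G - X = {} \<or> connected_graph (induced ?G (verts ?G - X))"
    and G': "G' = induced ?G (verts ?G - X)"
    using assms(2) unfolding moves_033_subdivided_star by blast
  \<comment> \<open>The tail of arm \<open>i\<close> from position \<open>m\<close> outwards is
    attached to the rest only through its inner neighbour (the centre if \<open>m = 0\<close>). If
    that vertex is deleted, the tail is cut off from any surviving \<open>y\<close> outside
    it.\<close>
  have separated: False
    if "i < length ls" "m < ls ! i" "Arm i m \<notin> X" "y \<in> verts ?G - X" "y \<notin> Arm i ` {m..}"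
      "m = 0 \<and> Centre \<in> X \<or> 0 < m \<and> Arm i (m - 1) \<in> X" for i m y
  proof -
    have "\<not> connected_graph (induced ?G (verts ?G - X))"
    proof (rule not_connected_graphI[where A = "Arm i ` {m..}" and x = "Arm i m" and y = y])
      show "edges (induced ?G (verts ?G - X)) `` Arm i ` {m..} \<subseteq> Arm i ` {m..}"
      proof
        fix z assume "z \<in> edges (induced ?G (verts ?G - X)) `` Arm i ` {m..}"
        then obtain n where n: "m \<le> n" "(Arm i n, z) \<in> edges ?G" "z \<notin> X"
          by (auto simp: induced_def)
        show "z \<in> Arm i ` {m..}"
        proof (cases z)
          case Centre
          with n that(6) show ?thesis by auto
        next
          case (Arm i' j)
          with n have "i' = i" by simp
          moreover have "m \<le> j"
          proof (rule ccontr)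
            assume "\<not> m \<le> j"
            with n Arm have "j = m - 1" "0 < m" by auto
            with that(6) n Arm \<open>i' = i\<close> show False by auto
          qed
          ultimately show ?thesis using Arm by auto
        qed
      qed
    qed (use that in \<open>auto simp: induced_def\<close>)
    with con that(4) show False by blast
  qed
  have centre: "Centre \<notin> X"
  proof
    assume C: "Centre \<in> X"
    \<comment> \<open>Besides the centre, \<open>X\<close> contains at most the first vertex of one
      arm \<open>k\<close>.\<close>
    obtain k where k: "X \<subseteq> {Centre, Arm k 0}"
    proof -
      from X consider u where "X = {u}" | u v where "(u, v) \<in> edges ?G" "X = {u, v}" by blast
      then show thesis
      proof cases
        case 1
        with C that show ?thesis by auto
      next
        case (2 u v)
        with C that show ?thesis by (cases u; cases v) auto
      qed
    qed
    \<comment> \<open>Of three arms, two remain untouched: arm \<open>i\<close> serves as the tail,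
      arm \<open>i'\<close> supplies the vertex outside it.\<close>
    obtain i where i: "i < length ls" "0 < ls ! i" "i \<noteq> k"
      using obtain_other_arm[of "{k}" ls] assms(1) by auto
    obtain i' where i': "i' < length ls" "0 < ls ! i'" "i' \<notin> {k, i}"
      using obtain_other_arm[of "{k, i}" ls] assms(1) i by auto
    show False
      using separated[of i 0 "Arm i' 0"] i i' k C by auto
  qed
  obtain i n d where X_eq: "X = Arm i ` {n..<n + d}" and d: "d \<in> {1, 2}"
    and i: "i < length ls" "n + d \<le> ls ! i"
  proof -
    from X consider u where "u \<in> verts ?G" "X = {u}"
      | u v where "(u, v) \<in> edges ?G" "X = {u, v}" by blast
    then show thesis
    proof cases
      case (1 u)
      with centre obtain i j where "u = Arm i j" by (cases u) auto
      with 1 show ?thesis by (intro that[of i j 1]) auto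
    next
      case (2 u v)
      with centre obtain i j i' j' where uv: "u = Arm i j" "v = Arm i' j'"
        by (cases u; cases v) auto
      have "{n..<n + 2} = {n, Suc n}" for n :: nat by auto
      \<comment> \<open>The minimum is the inner position, since the edge may be given in either
        direction.\<close>
      with 2 uv show ?thesis by (intro that[of i "min j j'" 2]) (auto simp: min_def)
    qed
  qed
  \<comment> \<open>Otherwise the part of the arm beyond the deleted block survives and is separated
    from the centre.\<close>
  have "n + d = ls ! i"
  proof (rule ccontr)
    assume "n + d \<noteq> ls ! i"
    then show False
      using separated[of i "n + d" Centre] i d X_eq by (auto simp: image_iff)
  qed
  then have "n = ls ! i - d" "d \<le> ls ! i" "X = Arm i ` {ls ! i - d..<ls ! i}"
    using X_eq by auto
  then show thesis
    using induced_subdivided_star_shorten[OF i(1), of d] d i(1) G'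
    by (intro that[of i d]) simp_all
qed

section \<open>Stars with at most two arms as paths\<close>

text \<open>The labelling \<open>f\<close> walks from the tip of arm \<open>i1\<close> inwards,
  meets the centre at position \<open>a\<close>, and continues outwards along arm \<open>i2\<close>.
  An index outside the list stands for an arm of length 0, which covers stars with no arm or one
  arm.\<close>

lemma subdivided_star_eq_path_graph:
  assumes "i1 \<noteq> i2" "\<And>i. i < length ls \<Longrightarrow> 0 < ls ! i \<Longrightarrow> i = i1 \<or> i = i2"
    and a: "a = (if i1 < length ls then ls ! i1 else 0)"
    and b: "b = (if i2 < length ls then ls ! i2 else 0)"
    and f: "f = (\<lambda>n. if n < a then Arm i1 (a - 1 - n) else if n = a then Centre
                 else Arm i2 (n - a - 1))"
  shows "inj_on f {0..<a + b + 1}" "subdivided_star ls = path_graph f 0 (a + b + 1)"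
proof -
  let ?P = "path_graph f 0 (a + b + 1)"
  have fC: "f n = Centre \<longleftrightarrow> n = a" "Centre = f n \<longleftrightarrow> n = a" for n by (auto simp: f)
  \<comment> \<open>\<open>fC\<close> and \<open>fA\<close> invert \<open>f\<close>; each is stated
    in both orientations for rewriting.\<close>
  have fA: "f n = Arm i j \<longleftrightarrow> i = i1 \<and> j < a \<and> n = a - 1 - j \<or> i = i2 \<and> n = a + 1 + j"
    "Arm i j = f n \<longleftrightarrow> i = i1 \<and> j < a \<and> n = a - 1 - j \<or> i = i2 \<and> n = a + 1 + j" for n i j
    by (auto simp: f)
  have arm: "i < length ls \<and> j < ls ! i \<longleftrightarrow> i = i1 \<and> j < a \<or> i = i2 \<and> j < b" for i j
    using assms(2)[of i] a b by auto
  show "inj_on f {0..<a + b + 1}"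
    using assms(1) by (auto simp: inj_on_def f split: if_splits)
  have V: "verts (subdivided_star ls) = verts ?P"
    by (intro star_vertex_set_eqI)
      (use arm in \<open>auto simp: path_graph_def image_iff Bex_def fC fA
          conj_disj_distribL ex_disj_distrib\<close>)
  have len1: "i1 < length ls \<and> k < ls ! i1 \<longleftrightarrow> k < a" for k
    using arm[of i1 k] assms(1) by blast
  have len2: "i2 < length ls \<and> k < ls ! i2 \<longleftrightarrow> k < b" for k
    using arm[of i2 k] assms(1) by blast
  have E: "edges (subdivided_star ls) = edges ?P"
  proof (intro equalityI subsetI)
    fix e assume "e \<in> edges ?P"
    then obtain n where n: "n < a + b" "e = (f n, f (Suc n)) \<or> e = (f (Suc n), f n)"
      by (auto simp: path_graph_def)
    consider "Suc n < a" | "Suc n = a" | "n = a" | "a < n" by linarith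
    then have "(f n, f (Suc n)) \<in> edges (subdivided_star ls) \<and>
      (f (Suc n), f n) \<in> edges (subdivided_star ls)"
    proof cases
      case 1
      then have "f (Suc n) = Arm i1 (a - 2 - n)" "f n = Arm i1 (Suc (a - 2 - n))"
        by (simp_all add: f)
      then show ?thesis using len1[of "Suc (a - 2 - n)"] 1 by simp
    next
      case 2
      then have "f (Suc n) = Centre" "f n = Arm i1 0" by (simp_all add: f)
      then show ?thesis using len1[of 0] 2 by simp
    next
      case 3
      then have "f (Suc n) = Arm i2 0" "f n = Centre" by (simp_all add: f)
      then show ?thesis using len2[of 0] 3 n by simp
    next
      case 4
      then have "f (Suc n) = Arm i2 (Suc (n - a - 1))" "f n = Arm i2 (n - a - 1)"
        by (simp_all add: f)
      then show ?thesis using len2[of "Suc (n - a - 1)"] 4 n by simp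
    qed
    with n show "e \<in> edges (subdivided_star ls)" by blast
  next
    fix e assume "e \<in> edges (subdivided_star ls)"
    then obtain x y where "(x, y) \<in> star_arcs ls" and e: "e = (x, y) \<or> e = (y, x)"
      by (cases e) (auto simp: subdivided_star_def)
    then consider i where "i < length ls \<and> 0 < ls ! i" "x = Centre" "y = Arm i 0"
      | i j where "i < length ls \<and> Suc j < ls ! i" "x = Arm i j" "y = Arm i (Suc j)"
      by (auto simp: star_arcs_def)
    then have "\<exists>n<a + b. (x, y) = (f n, f (Suc n)) \<or> (x, y) = (f (Suc n), f n)"
    proof cases
      case (1 i)
      then consider "i = i1" "0 < a" | "i = i2" "0 < b" using arm by blast
      then show ?thesis
      proof cases
        case 1
        then show ?thesis using \<open>x = _\<close> \<open>y = _\<close> by (intro exI[of _ "a - 1"]) (simp add: f)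
      next
        case 2
        then show ?thesis using \<open>x = _\<close> \<open>y = _\<close> by (intro exI[of _ a]) (simp add: f)
      qed
    next
      case (2 i j)
      then consider "i = i1" "Suc j < a" | "i = i2" "Suc j < b" using arm by blast
      then show ?thesis
      proof cases
        case 1
        then show ?thesis
          using \<open>x = _\<close> \<open>y = _\<close> by (intro exI[of _ "a - 2 - j"]) (auto simp: f)
      next
        case 2
        then show ?thesis
          using \<open>x = _\<close> \<open>y = _\<close> by (intro exI[of _ "a + 1 + j"]) (simp add: f)
      qed
    qed
    with e show "e \<in> edges ?P" by (auto simp: path_graph_def)
  qed
  show "subdivided_star ls = ?P"
    using V E by (rule ugraph.expand[OF conjI])
qed

text \<open>Such a star is a path whose vertices are those of the arms and the centre, which
  accounts for the \<open>+ 1\<close>.\<close>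

lemma grundy_033_few_arms:
  assumes "num_arms ls \<le> 2"
  shows "grundy_033 (subdivided_star ls) = (sum_list ls + 1) mod 3"
proof -
  let ?S = "{i. i < length ls \<and> 0 < ls ! i}"
  have "finite ?S" by simp
  \<comment> \<open>The set of arms is padded to exactly two indices, possibly with entries 0 or
    indices beyond the list.\<close>
  obtain T where T: "?S \<subseteq> T" "card T = 2" "finite T"
  proof -
    obtain B where "B \<subseteq> UNIV - ?S" "finite B" "card B = 2 - card ?S"
      using infinite_arbitrarily_large[of "UNIV - ?S" "2 - card ?S"] by auto
    moreover from this have "card (?S \<union> B) = 2"
      using assms by (subst card_Un_disjoint) (auto simp: num_arms_eq_card)
    ultimately show thesis using that[of "?S \<union> B"] by auto
  qed
  then obtain i1 i2 where i: "T = {i1, i2}" "i1 \<noteq> i2"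
    by (meson card_2_iff)
  define l where "l i = (if i < length ls then ls ! i else 0)" for i
  have "sum_list ls = sum l {..<length ls}"
    by (simp add: sum_list_sum_nth l_def atLeast0LessThan)
  also have "\<dots> = sum l ?S"
    by (rule sum.mono_neutral_right) (auto simp: l_def)
  also have "\<dots> = sum l T"
    using T by (intro sum.mono_neutral_left) (auto simp: l_def)
  finally have "sum_list ls = l i1 + l i2" using i by simp
  moreover have arms: "i = i1 \<or> i = i2" if "i < length ls" "0 < ls ! i" for i
    using T(1) i(1) that by auto
  obtain f where "inj_on f {0..<l i1 + l i2 + 1}"
    "subdivided_star ls = path_graph f 0 (l i1 + l i2 + 1)"
    using subdivided_star_eq_path_graph[OF i(2) arms l_def l_def refl] by blast
  ultimately show ?thesis
    using grundy_033_path_graph[of f 0 "l i1 + l i2 + 1"] by simp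
qed

section \<open>Periodicity of the arm lengths\<close>

lemma sum_list_le_1_eq_num_arms: "\<forall>l\<in>set ls. l \<le> 1 \<Longrightarrow> sum_list ls = num_arms ls"
  by (induction ls) (auto simp: num_arms_def)

lemma sum_list_shorten:
  fixes ls :: "nat list"
  assumes "i < length ls" "d \<le> ls ! i"
  shows "sum_list (ls[i := ls ! i - d]) = sum_list ls - d"
  using assms member_le_sum_list[of "ls ! i" ls] by (simp add: sum_list_update)

text \<open>Only index \<open>i\<close> can become a new arm. Hence three arms after a lengthening
  mean at least two before it.\<close>

lemma num_arms_update_le:
  assumes "i < length ls"
  shows "num_arms (ls[i := x]) \<le> Suc (num_arms ls)"
proof -
  have "{k. k < length ls \<and> 0 < ls[i := x] ! k} \<subseteq> insert i {k. k < length ls \<and> 0 < ls ! k}"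
    by (auto simp: nth_list_update)
  from card_mono[OF _ this] show ?thesis
    by (simp add: num_arms_eq_card card_insert_if split: if_splits)
qed

lemma num_arms_mono:
  assumes "length ls = length ls'" "\<And>i. i < length ls \<Longrightarrow> ls ! i \<le> ls' ! i"
  shows "num_arms ls \<le> num_arms ls'"
  unfolding num_arms_eq_card
  by (rule card_mono) (use assms in \<open>auto intro: less_le_trans\<close>)

text \<open>The moves that delete the centre are dispensable. They exist only on paths, and there
  deleting from the other end does the same, except on \<open>S\<^bsub>1,1\<^esub>\<close>, whose value is 0.\<close>

lemma less_grundy_033_obtain_shorten:
  assumes "2 \<le> num_arms ls" "m < grundy_033 (subdivided_star ls)"
  obtains i d where "i < length ls" "d \<in> {1, 2}" "d \<le> ls ! i"
    "grundy_033 (subdivided_star (ls[i := ls ! i - d])) = m"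
proof (cases "3 \<le> num_arms ls")
  case True
  with assms(2) that show thesis
    by (metis less_grundy_033_obtain_move moves_033_many_arms)
next
  case False
  then have arms: "num_arms ls = 2" using assms(1) by simp
  then have m: "m < (sum_list ls + 1) mod 3" using assms(2) grundy_033_few_arms by simp
  \<comment> \<open>Two arms of length 1 give a path on three vertices, of value 0, and no
    \<open>m\<close> lies below that.\<close>
  have "\<exists>l\<in>set ls. 2 \<le> l"
  proof (rule ccontr)
    assume "\<not> (\<exists>l\<in>set ls. 2 \<le> l)"
    then have "sum_list ls = 2"
      using sum_list_le_1_eq_num_arms[of ls] arms by fastforce
    with m show False by simp
  qed
  \<comment> \<open>This arm is long enough for either \<open>d\<close>, so the required number of
    vertices can be taken from it.\<close>
  then obtain i where i: "i < length ls" "2 \<le> ls ! i" by (metis in_set_conv_nth)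
  then have "2 \<le> sum_list ls"
    using member_le_sum_list[of "ls ! i" ls] by simp
  moreover obtain d where "d \<in> {1, 2}" "(sum_list ls + 1 - d) mod 3 = m"
    using m by (rule less_mod_3_obtain_diff)
  moreover from calculation have "sum_list ls + 1 - d = sum_list ls - d + 1" by auto
  ultimately have d: "d \<in> {1, 2}" "(sum_list ls - d + 1) mod 3 = m" by simp_all
  have le: "d \<le> ls ! i" using d i by auto
  have "num_arms (ls[i := ls ! i - d]) \<le> num_arms ls"
    using i(1) by (intro num_arms_mono) (auto simp: nth_list_update)
  then have "grundy_033 (subdivided_star (ls[i := ls ! i - d])) = m"
    using arms d sum_list_shorten[OF i(1) le] by (simp add: grundy_033_few_arms)
  with that i(1) d(1) le show thesis by blast
qed

lemma grundy_033_lengthen_arm_3: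
  assumes "i < length ls"
  shows "grundy_033 (subdivided_star (ls[i := ls ! i + 3])) = grundy_033 (subdivided_star ls)"
  using assms
proof (induction "sum_list ls" arbitrary: ls rule: less_induct)
  case less
  let ?ls' = "ls[i := ls ! i + 3]"
  have IH: "grundy_033 (subdivided_star (?ls'[k := ?ls' ! k - d])) =
      grundy_033 (subdivided_star (ls[k := ls ! k - d]))"
    if "k < length ls" "d \<in> {1, 2}" "d \<le> ls ! k" for k d
  proof -
    let ?t = "ls[k := ls ! k - d]"
    have "sum_list ?t < sum_list ls"
      using that member_le_sum_list[of "ls ! k" ls] by (auto simp: sum_list_shorten)
    then have "grundy_033 (subdivided_star (?t[i := ?t ! i + 3])) = grundy_033 (subdivided_star ?t)"
      using less by simp
    \<comment> \<open>Shortening arm \<open>k\<close> and lengthening arm \<open>i\<close> commute;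
      for \<open>k = i\<close> this relies on \<open>d \<le> ls ! k\<close>, as subtraction
      truncates.\<close>
    moreover have "?t[i := ?t ! i + 3] = ?ls'[k := ?ls' ! k - d]"
      using that less.prems by (cases "k = i") (auto simp: list_update_swap)
    ultimately show ?thesis by simp
  qed
  show ?case
  \<comment> \<open>The split concerns the lengthened star, whose moves must be classified. If
    \<open>ls ! i = 0\<close>, then \<open>ls\<close> may have only two arms while
    \<open>?ls'\<close> has three.\<close>
  proof (cases "num_arms ?ls' \<le> 2")
    case True
    have "num_arms ls \<le> num_arms ?ls'"
      using less.prems by (intro num_arms_mono) (auto simp: nth_list_update)
    then have few: "num_arms ls \<le> 2" using True by simp
    have "ls ! i \<le> sum_list ls"
      using less.prems by (intro member_le_sum_list) auto
    then have "sum_list ?ls' + 1 = sum_list ls + 1 + 3"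
      using less.prems by (simp add: sum_list_update)
    then have "(sum_list ?ls' + 1) mod 3 = (sum_list ls + 1) mod 3"
      by (metis mod_add_self2)
    then show ?thesis
      unfolding grundy_033_few_arms[OF few] grundy_033_few_arms[OF True] .
  next
    case False
    show ?thesis
    proof (rule grundy_033_eqI)
      fix G' assume "G' \<in> moves_033 (subdivided_star ?ls')"
      then obtain k d where kd: "k < length ls" "d \<in> {1, 2}" "d \<le> ?ls' ! k"
        and G': "G' = subdivided_star (?ls'[k := ?ls' ! k - d])"
        using False moves_033_many_arms[of ?ls' G'] by auto
      show "grundy_033 G' \<noteq> grundy_033 (subdivided_star ls)"
      proof (cases "k = i")
        case True
        \<comment> \<open>Answering the removal of \<open>d\<close> by a removal of
          \<open>3 - d\<close>, again 1 or 2, restores \<open>ls\<close>.\<close>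
        let ?t = "ls[i := ls ! i + 3 - d]"
        have "?t[i := ?t ! i - (3 - d)] = ls" using kd True by auto
        moreover have "G' = subdivided_star ?t" using G' True kd by simp
        ultimately have "subdivided_star ls \<in> moves_033 G'"
          using shorten_arm_in_moves_033[of i ?t "3 - d"] kd True by auto
        then show ?thesis using grundy_033_move_neq by metis
      next
        case False
        then have "d \<le> ls ! k" using kd by simp
        then show ?thesis
          using IH[of k d] G' kd shorten_arm_in_moves_033[of k ls d] grundy_033_move_neq by metis
      qed
    next
      fix m assume "m < grundy_033 (subdivided_star ls)"
      moreover have "2 \<le> num_arms ls"
        using False num_arms_update_le[OF less.prems, of "ls ! i + 3"] by simp
      ultimately obtain k d where kd: "k < length ls" "d \<in> {1, 2}" "d \<le> ls ! k"
        "grundy_033 (subdivided_star (ls[k := ls ! k - d])) = m"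
        by (meson less_grundy_033_obtain_shorten)
      have "d \<le> ?ls' ! k"
        using kd(3) less.prems by (simp add: nth_list_update)
      moreover have "k < length ?ls'" using kd(1) by simp
      ultimately have
        "subdivided_star (?ls'[k := ?ls' ! k - d]) \<in> moves_033 (subdivided_star ?ls')"
        using kd(2) by (intro shorten_arm_in_moves_033)
      then show "\<exists>G'\<in>moves_033 (subdivided_star ?ls'). grundy_033 G' = m"
        using IH[OF kd(1-3)] kd(4) by (intro bexI) (rule trans)
    qed
  qed
qed

text \<open>Entries are lowered by 3 until all are below 3. An arm of length 3 becomes an entry 0 on
  the way, so the induction ranges over lists with zeros.\<close>

lemma grundy_033_subdivided_star_mod_3:
  "grundy_033 (subdivided_star ls) = grundy_033 (subdivided_star (map (\<lambda>l. l mod 3) ls))"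
proof (induction "sum_list ls" arbitrary: ls rule: less_induct)
  case less
  show ?case
  proof (cases "\<exists>i<length ls. 3 \<le> ls ! i")
    case True
    then obtain i where i: "i < length ls" "3 \<le> ls ! i" by blast
    let ?t = "ls[i := ls ! i - 3]"
    have "sum_list ?t < sum_list ls"
      using i member_le_sum_list[of "ls ! i" ls] by (auto simp: sum_list_shorten)
    then have "grundy_033 (subdivided_star ?t) =
        grundy_033 (subdivided_star (map (\<lambda>l. l mod 3) ?t))"
      by (rule less)
    moreover have "map (\<lambda>l. l mod 3) ?t = map (\<lambda>l. l mod 3) ls"
      using i by (intro nth_equalityI) (auto simp: nth_list_update le_mod_geq)
    moreover have "grundy_033 (subdivided_star ls) = grundy_033 (subdivided_star ?t)"
      using grundy_033_lengthen_arm_3[of i ?t] i by simp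
    ultimately show ?thesis by simp
  next
    case False
    then have "map (\<lambda>l. l mod 3) ls = ls"
      by (intro nth_equalityI) auto
    then show ?thesis by simp
  qed
qed

theorem theorem2:
  fixes ls :: "nat list"
  assumes "\<forall>l\<in>set ls. l \<ge> 1"
  shows "grundy_033 (subdivided_star ls) = grundy_033 (subdivided_star (map (\<lambda>l. l mod 3) ls))"
  by (rule grundy_033_subdivided_star_mod_3)

end
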